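(* Let $X$ be a Banach space, let $A,B\in ck(X)$ have support functions $s(\cdot,A)$, $s(\cdot,B)$, and put $s_1:=s(\cdot,A)-s(\cdot,B)$ and $s_2:=s(\cdot,B)-s(\cdot,A)$. Then only four cases may occur: (a) if $s_1$ and $s_2$ are both $bw^*$-continuous and subadditive, then $A\ominus_gB\in ck(X)$ exists and $A\ominus_gB$ is a singleton; (b) if only $s_1$ is $bw^*$-continuous and subadditive, then $C=A\ominus_gB$ exists with $A=B+C$, and $s(\cdot,C)=s_1$; (c) if only $s_2$ is $bw^*$-continuous and subadditive, then $C=A\ominus_gB$ exists with $B=A+(-C)$, and $s(\cdot,C)=s(\cdot,-B)-s(\cdot,-A)$; (d) if neither $s_1$ nor $s_2$ is $bw^*$-continuous and subadditive, then $A\ominus_gB$ does not exist.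
   Context: $ck(X)$ is the family of nonempty compact convex subsets of the Banach space $X$; $A+B=\{a+b:a\in A,b\in B\}$ and $-A=\{-a:a\in A\}$. The support function of $C\in ck(X)$ is $s(x^*,C)=\sup\{\langle x^*,c\rangle:c\in C\}$; support functions and $s_1,s_2$ are considered as functions on the closed unit ball $B_{X^*}$ of $X^*$ (subadditivity being understood for $x^*,y^*$ with $x^*,y^*,x^*+y^*\in B_{X^*}$). The $bw^*$ (bounded-weak-star) topology on $B_{X^*}$ is the strongest topology that coincides with the weak$^*$ topology on every ball $\{x^*\in B_{X^*}:\|x^*\|\le r\}$. For $A,B\in ck(X)$, the generalized Hukuhara difference $A\ominus_gB$, when it exists, is the (unique) set $C\in ck(X)$ such that (i) $A=B+C$, or (ii) $B=A+(-C)$. *)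

theory Defs
  imports "HOL-Analysis.Analysis"
begin

definition ck :: "'a::banach set set"
  where "ck = {C. C \<noteq> {} \<and> compact C \<and> convex C}"

definition support_fun :: "'a::banach set \<Rightarrow> ('a \<Rightarrow>\<^sub>L real) \<Rightarrow> real"
  where "support_fun C f = (SUP c\<in>C. blinfun_apply f c)"

abbreviation dual_ball :: "('a::banach \<Rightarrow>\<^sub>L real) set"
  where "dual_ball \<equiv> cball 0 1"

definition subadditive_on :: "'v::plus set \<Rightarrow> ('v \<Rightarrow> real) \<Rightarrow> bool"
  where "subadditive_on S p \<longleftrightarrow> (\<forall>f\<in>S. \<forall>g\<in>S. f + g \<in> S \<longrightarrow> p (f + g) \<le> p f + p g)"

text \<open>For scalar-valued operators the strong operator topology is the topology of pointwise
  convergence on the dual space.\<close>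

abbreviation weak_star_topology :: "('a::banach \<Rightarrow>\<^sub>L real) topology"
  where "weak_star_topology \<equiv> strong_operator_topology"

definition coincides_weak_star_on_balls :: "('a::banach \<Rightarrow>\<^sub>L real) topology \<Rightarrow> bool"
  where "coincides_weak_star_on_balls T \<longleftrightarrow>
    topspace T = dual_ball \<and>
    (\<forall>r. subtopology T {f \<in> dual_ball. norm f \<le> r} =
         subtopology weak_star_topology {f \<in> dual_ball. norm f \<le> r})"

definition is_bw_star_topology :: "('a::banach \<Rightarrow>\<^sub>L real) topology \<Rightarrow> bool"
  where "is_bw_star_topology T \<longleftrightarrow>
    coincides_weak_star_on_balls T \<and>
    (\<forall>T'. coincides_weak_star_on_balls T' \<longrightarrow> (\<forall>U. openin T' U \<longrightarrow> openin T U))"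

definition bw_star_topology :: "('a::banach \<Rightarrow>\<^sub>L real) topology"
  where "bw_star_topology = (THE T. is_bw_star_topology T)"

lemma is_bw_star_topology_bw_star_topology:
  "is_bw_star_topology (bw_star_topology :: ('a::banach \<Rightarrow>\<^sub>L real) topology)"
proof -
  let ?W = "subtopology weak_star_topology dual_ball :: ('a \<Rightarrow>\<^sub>L real) topology"
  have ball1: "{f \<in> dual_ball. norm f \<le> 1} = (dual_ball :: ('a \<Rightarrow>\<^sub>L real) set)"
    by auto
  have Int_ball: "dual_ball \<inter> {f \<in> dual_ball. norm f \<le> r} =
      {f \<in> dual_ball :: ('a \<Rightarrow>\<^sub>L real) set. norm f \<le> r}" for r
    by (rule Int_absorb1) (rule Collect_restrict)
  have coincide: "coincides_weak_star_on_balls ?W"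
    unfolding coincides_weak_star_on_balls_def
    by (simp only: subtopology_subtopology topspace_subtopology Int_ball
        strong_operator_topology_topspace Int_UNIV_left simp_thms)
  have unique: "T = ?W" if T: "coincides_weak_star_on_balls T" for T
  proof -
    have top: "topspace T = dual_ball"
      using T unfolding coincides_weak_star_on_balls_def by (rule conjunct1)
    have "subtopology T {f \<in> dual_ball. norm f \<le> 1} =
        subtopology weak_star_topology {f \<in> dual_ball. norm f \<le> 1}"
      using T[unfolded coincides_weak_star_on_balls_def, THEN conjunct2]
      by (rule spec[where x = 1])
    then have "subtopology T (topspace T) = ?W"
      by (simp only: ball1 top)
    then show ?thesis
      by (simp only: subtopology_topspace)
  qed
  have "is_bw_star_topology ?W"
    unfolding is_bw_star_topology_def
  proof (intro conjI allI impI)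
    fix T' :: "('a \<Rightarrow>\<^sub>L real) topology" and U
    assume T': "coincides_weak_star_on_balls T'" and U: "openin T' U"
    show "openin ?W U"
      by (rule subst[OF unique[OF T'], where P = "\<lambda>S. openin S U", OF U])
  qed (rule coincide)
  moreover have "T = ?W" if "is_bw_star_topology T" for T
    using that[unfolded is_bw_star_topology_def, THEN conjunct1] by (rule unique)
  ultimately show ?thesis
    unfolding bw_star_topology_def by (rule theI)
qed

definition bw_star_continuous :: "(('a::banach \<Rightarrow>\<^sub>L real) \<Rightarrow> real) \<Rightarrow> bool"
  where "bw_star_continuous p \<longleftrightarrow> continuous_map bw_star_topology euclidean p"

text \<open>The sum of sets is the elementwise sum from \<open>Set_Algebras\<close>, but unary minus on sets is
  the complement; \<open>-A\<close> is therefore written as the image \<open>uminus ` A\<close>.\<close>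

definition is_gH_diff :: "'a::banach set \<Rightarrow> 'a set \<Rightarrow> 'a set \<Rightarrow> bool"
  where "is_gH_diff A B C \<longleftrightarrow> C \<in> ck \<and> (A = B + C \<or> B = A + uminus ` C)"

definition gH_diff_exists :: "'a::banach set \<Rightarrow> 'a set \<Rightarrow> bool"
  where "gH_diff_exists A B \<longleftrightarrow> (\<exists>C. is_gH_diff A B C)"

text \<open>The value is meaningful only when \<open>gH_diff_exists A B\<close>; for \<open>A, B \<in> ck\<close> the set is
  then unique.\<close>

definition gH_diff :: "'a::banach set \<Rightarrow> 'a set \<Rightarrow> 'a set"  (infixl "\<ominus>\<^sub>g" 65)
  where "A \<ominus>\<^sub>g B = (THE C. is_gH_diff A B C)"

end

theory Submission
  imports Defs
begin

text \<open>Continuity of \<open>s1\<close> and \<open>s2\<close> is automatic, since support functions of norm compact sets are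
  weak-star continuous on bounded sets; everything hinges on subadditivity. If
  \<open>s = s(\<sqdot>, A) - s(\<sqdot>, B)\<close> is subadditive, let \<open>C\<close> be the set of \<open>c\<close> with \<open>f c \<le> s f\<close> for all \<open>f\<close>.
  By Hahn--Banach \<open>B + C \<subseteq> A\<close>. Conversely, for \<open>a \<in> A\<close> we need \<open>b \<in> B\<close> with \<open>f (a - b) \<le> s f\<close> for
  all \<open>f\<close>: by compactness of \<open>B\<close> finitely many \<open>f\<close> at a time suffice, and a finite system is solvable
  because for nonnegative weights \<open>u\<close> and \<open>h = \<Sum> u f \<cdot> f\<close> a maximizer \<open>b\<close> of \<open>h\<close> on \<open>B\<close> satisfies
  \<open>h (a - b) \<le> s h \<le> \<Sum> u f \<cdot> s f\<close>. Hence \<open>A = B + C\<close> without Krein--Smulian.\<close>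

section \<open>Sublinear functionals and the Hahn--Banach theorem\<close>

definition sublinear :: "('v::real_vector \<Rightarrow> real) \<Rightarrow> bool"
  where "sublinear p \<longleftrightarrow> (\<forall>x y. p (x + y) \<le> p x + p y) \<and> (\<forall>c\<ge>0. \<forall>x. p (c *\<^sub>R x) = c * p x)"

text \<open>Applying the scaling inequality with \<open>inverse c\<close> to
  \<open>c *\<^sub>R x\<close> yields its own converse, so one direction for positive
  \<open>c\<close> suffices.\<close>

lemma sublinearI:
  assumes zero: "p 0 = 0"
    and add: "\<And>x y. p (x + y) \<le> p x + p y"
    and scale: "\<And>c x. c > 0 \<Longrightarrow> p (c *\<^sub>R x) \<le> c * p x"
  shows "sublinear p"
proof -
  have "p (c *\<^sub>R x) = c * p x" if "c \<ge> 0" for c x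
  proof (cases "c = 0")
    case False
    then have c: "c > 0" using that by simp
    have "p (inverse c *\<^sub>R (c *\<^sub>R x)) \<le> inverse c * p (c *\<^sub>R x)"
      using c by (intro scale) simp
    then have "c * p x \<le> p (c *\<^sub>R x)"
      using c by (simp add: field_simps)
    with scale[OF c, of x] show ?thesis by simp
  qed (simp add: zero)
  with add show ?thesis unfolding sublinear_def by blast
qed

lemma sublinear_add: "sublinear p \<Longrightarrow> p (x + y) \<le> p x + p y"
  and sublinear_scale: "sublinear p \<Longrightarrow> c \<ge> 0 \<Longrightarrow> p (c *\<^sub>R x) = c * p x"
  unfolding sublinear_def by blast+

lemma sublinear_0: "sublinear p \<Longrightarrow> p 0 = 0"
  using sublinear_scale[of p 0 0] by simp

lemma sublinear_minus: "sublinear p \<Longrightarrow> - p (- x) \<le> p x"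
  using sublinear_add[of p x "- x"] sublinear_0[of p] by simp

lemma sublinear_sum:
  assumes "sublinear p" "finite I" "\<And>i. i \<in> I \<Longrightarrow> u i \<ge> 0"
  shows "p (\<Sum>i\<in>I. u i *\<^sub>R x i) \<le> (\<Sum>i\<in>I. u i * p (x i))"
  using assms(2,3)
proof (induction I)
  case empty
  then show ?case using sublinear_0[OF assms(1)] by simp
next
  case (insert i I)
  have "p (\<Sum>j\<in>insert i I. u j *\<^sub>R x j) \<le> p (u i *\<^sub>R x i) + p (\<Sum>j\<in>I. u j *\<^sub>R x j)"
    using insert by (simp add: sublinear_add[OF assms(1)])
  also have "\<dots> \<le> u i * p (x i) + (\<Sum>j\<in>I. u j * p (x j))"
    using insert by (simp add: sublinear_scale[OF assms(1)])
  finally show ?case using insert by simp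
qed

lemma sublinear_norm: "sublinear (norm :: 'v::real_normed_vector \<Rightarrow> real)"
  by (rule sublinearI) (auto simp: norm_triangle_ineq)

text \<open>The extension step of Hahn--Banach: the minorant is the infimum of
  \<open>p (x + t *\<^sub>R d) - t * \<delta>\<close> over t \<ge> 0 and d in \<open>D\<close>. A
  singleton \<open>D\<close> serves the linearity of minimal functionals, a translate of a convex
  set serves separation.\<close>

lemma sublinear_minorant_convex:
  fixes p :: "'v::real_vector \<Rightarrow> real"
  assumes p: "sublinear p" and D: "convex D" "D \<noteq> {}" and ge: "\<And>d. d \<in> D \<Longrightarrow> \<delta> \<le> p d"
  obtains q where "sublinear q" "\<And>x. q x \<le> p x" "\<And>d. d \<in> D \<Longrightarrow> q (- d) \<le> - \<delta>"
proof -
  define K where "K = {(t :: real, d). t \<ge> 0 \<and> d \<in> D}"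
  define h where "h x k = p (x + fst k *\<^sub>R snd k) - fst k * \<delta>" for x and k :: "real \<times> 'v"
  define q where "q x = (INF k\<in>K. h x k)" for x
  obtain d0 where d0: "d0 \<in> D" using D by blast
  then have K_ne: "K \<noteq> {}" unfolding K_def by force
  have K_E: thesis if "k \<in> K" "\<And>t d. k = (t, d) \<Longrightarrow> t \<ge> 0 \<Longrightarrow> d \<in> D \<Longrightarrow> thesis" for k thesis
    using that unfolding K_def by blast
  \<comment> \<open>A lower bound independent of \<open>k\<close> makes the infimum finite; this is
    where \<delta> \<le> p d enters.\<close>
  have lower: "- p (- x) \<le> h x k" if "k \<in> K" for x k
  proof -
    from that obtain t d where k: "k = (t, d)" "t \<ge> 0" "d \<in> D" by (rule K_E)
    have "t * \<delta> \<le> t * p d" using k ge by (simp add: mult_left_mono)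
    also have "\<dots> = p ((x + t *\<^sub>R d) + - x)" using k p by (simp add: sublinear_scale)
    also have "\<dots> \<le> p (x + t *\<^sub>R d) + p (- x)" by (rule sublinear_add[OF p])
    finally show ?thesis unfolding h_def k by simp
  qed
  then have bdd: "bdd_below (h x ` K)" for x by (intro bdd_belowI2) blast
  have q_le: "q x \<le> h x k" if "k \<in> K" for x k
    unfolding q_def by (rule cINF_lower[OF bdd that])
  have q_ge: "m \<le> q x" if "\<And>k. k \<in> K \<Longrightarrow> m \<le> h x k" for m x
    unfolding q_def by (rule cINF_greatest[OF K_ne that])
  \<comment> \<open>The parameter t = 0 switches the perturbation off.\<close>
  have q_le_p: "q x \<le> p x" for x
    using q_le[of "(0, d0)" x] d0 by (simp add: K_def h_def)
  have "sublinear q"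
  proof (rule sublinearI)
    show "q 0 = 0"
      using q_le_p[of 0] q_ge[of 0 0] lower[of _ 0] by (simp add: sublinear_0[OF p])
  next
    fix x y
    have *: "q (x + y) \<le> h x k + h y l" if kl: "k \<in> K" "l \<in> K" for k l
    proof -
      obtain t d where k: "k = (t, d)" "t \<ge> 0" "d \<in> D" using kl(1) by (rule K_E)
      obtain s e where l: "l = (s, e)" "s \<ge> 0" "e \<in> D" using kl(2) by (rule K_E)
      \<comment> \<open>Convexity merges the two perturbations into one with parameter t + s. If t +
        s = 0, both vanish and any point of \<open>D\<close> will do.\<close>
      obtain c where c: "c \<in> D" "(t + s) *\<^sub>R c = t *\<^sub>R d + s *\<^sub>R e"
      proof (cases "t + s = 0")
        case True
        then have "t = 0" "s = 0" using k l by auto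
        then show ?thesis using that[OF d0] by simp
      next
        case False
        then have pos: "t + s > 0" using k l by simp
        have "(t / (t + s)) *\<^sub>R d + (s / (t + s)) *\<^sub>R e \<in> D"
          using D(1) k l pos by (intro convexD) (auto simp: add_divide_distrib[symmetric])
        then show ?thesis using pos by (intro that) (auto simp: scaleR_add_right)
      qed
      have "q (x + y) \<le> h (x + y) (t + s, c)"
        using k l c by (intro q_le) (auto simp: K_def)
      also have "\<dots> = p ((x + t *\<^sub>R d) + (y + s *\<^sub>R e)) - (t + s) * \<delta>"
      proof -
        have "x + y + (t + s) *\<^sub>R c = (x + t *\<^sub>R d) + (y + s *\<^sub>R e)" by (simp add: c(2))
        then show ?thesis by (simp only: h_def fst_conv snd_conv)
      qed
      also have "\<dots> \<le> h x k + h y l"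
        using sublinear_add[OF p, of "x + t *\<^sub>R d" "y + s *\<^sub>R e"]
        by (simp add: h_def k l algebra_simps)
      finally show ?thesis .
    qed
    \<comment> \<open>The infimum is taken over the second parameter with the first one fixed, and
      then over the first.\<close>
    have "q (x + y) - q y \<le> h x k" if "k \<in> K" for k
      using q_ge[of "q (x + y) - h x k" y] *[OF that] by (simp add: algebra_simps)
    from q_ge[OF this] show "q (x + y) \<le> q x + q y" by simp
  next
    fix c :: real and x :: 'v
    assume c: "c > 0"
    have "q (c *\<^sub>R x) / c \<le> h x k" if "k \<in> K" for k
    proof -
      from that obtain t d where k: "k = (t, d)" "t \<ge> 0" "d \<in> D" by (rule K_E)
      have "q (c *\<^sub>R x) \<le> h (c *\<^sub>R x) (c * t, d)" using k c by (intro q_le) (auto simp: K_def)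
      also have "\<dots> = p (c *\<^sub>R (x + t *\<^sub>R d)) - c * t * \<delta>" by (simp add: h_def algebra_simps)
      also have "\<dots> = c * h x k" 
        using sublinear_scale[OF p, of c "x + t *\<^sub>R d"] c
        by (simp add: h_def k right_diff_distrib mult.assoc)
      finally show ?thesis using c by (simp add: field_simps)
    qed
    from q_ge[OF this] show "q (c *\<^sub>R x) \<le> c * q x" using c by (simp add: field_simps)
  qed
  \<comment> \<open>At t = 1 the perturbation cancels the argument - d, leaving p 0 -
    \<delta>.\<close>
  moreover have "q (- d) \<le> - \<delta>" if "d \<in> D" for d
    using q_le[of "(1, d)" "- d"] that by (simp add: K_def h_def sublinear_0[OF p])
  ultimately show ?thesis using that q_le_p by blast
qed

text \<open>Supplies the bounds of chains for Zorn's lemma. The common majorant \<open>p\<close>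
  forces q x \<ge> - p (- x), so the pointwise infimum is finite.\<close>

lemma sublinear_INF_chain:
  fixes p :: "'v::real_vector \<Rightarrow> real"
  assumes C: "C \<noteq> {}" and sub: "\<And>q. q \<in> C \<Longrightarrow> sublinear q" and le: "\<And>q x. q \<in> C \<Longrightarrow> q x \<le> p x"
    and chain: "\<And>q r. q \<in> C \<Longrightarrow> r \<in> C \<Longrightarrow> (\<forall>x. q x \<le> r x) \<or> (\<forall>x. r x \<le> q x)"
  shows "sublinear (\<lambda>x. INF q\<in>C. q x)" and "q \<in> C \<Longrightarrow> (INF q\<in>C. q x) \<le> q x"
proof -
  define u where "u x = (INF q\<in>C. q x)" for x
  have "- p (- x) \<le> q x" if "q \<in> C" for q x
    using sublinear_minus[OF sub[OF that], of x] le[OF that, of "- x"] by simp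
  then have bdd: "bdd_below ((\<lambda>q. q x) ` C)" for x by (intro bdd_belowI2) blast
  have u_le: "u x \<le> q x" if "q \<in> C" for q x
    unfolding u_def by (rule cINF_lower[OF bdd that])
  have u_ge: "m \<le> u x" if "\<And>q. q \<in> C \<Longrightarrow> m \<le> q x" for m x
    unfolding u_def by (rule cINF_greatest[OF C that])
  have "sublinear u"
  proof (rule sublinearI)
    show "u 0 = 0"
      using C u_le[of _ 0] u_ge[of 0 0] sublinear_0[OF sub] by fastforce
  next
    fix x y
    \<comment> \<open>Of two members of the chain the smaller one is subadditive and lies below
      both; this is the only use of comparability.\<close>
    have *: "u (x + y) \<le> q x + r y" if qr: "q \<in> C" "r \<in> C" for q r
      using chain[OF qr]
    proof
      assume "\<forall>x. q x \<le> r x"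
      then show ?thesis
        using u_le[OF qr(1), of "x + y"] sublinear_add[OF sub[OF qr(1)], of x y]
        by (smt (verit))
    next
      assume "\<forall>x. r x \<le> q x"
      then show ?thesis
        using u_le[OF qr(2), of "x + y"] sublinear_add[OF sub[OF qr(2)], of x y]
        by (smt (verit))
    qed
    have "u (x + y) - u y \<le> q x" if "q \<in> C" for q
      using u_ge[of "u (x + y) - q x" y] *[OF that] by (simp add: algebra_simps)
    then have "u (x + y) - u y \<le> u x" by (rule u_ge)
    then show "u (x + y) \<le> u x + u y" by simp
  next
    fix c :: real and x :: 'v
    assume c: "c > 0"
    have "u (c *\<^sub>R x) / c \<le> q x" if "q \<in> C" for q
      using u_le[OF that, of "c *\<^sub>R x"] sublinear_scale[OF sub[OF that], of c x] c
      by (simp add: field_simps)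
    then have "u (c *\<^sub>R x) / c \<le> u x" by (rule u_ge)
    then show "u (c *\<^sub>R x) \<le> c * u x" using c by (simp add: field_simps)
  qed
  then show "sublinear (\<lambda>x. INF q\<in>C. q x)" unfolding u_def .
  show "(INF q\<in>C. q x) \<le> q x" if "q \<in> C"
    using u_le[OF that] unfolding u_def .
qed

text \<open>A minimal sublinear functional below \<open>p\<close> is linear: otherwise
  \<open>sublinear_minorant_convex\<close>, applied to a singleton, would produce a smaller one.\<close>

lemma sublinear_dominates_linear:
  fixes p :: "'v::real_vector \<Rightarrow> real"
  assumes p: "sublinear p"
  obtains f where "linear f" "\<And>x. f x \<le> p x"
proof -
  define Q where "Q = {q. sublinear q \<and> (\<forall>x. q x \<le> p x)}"
  \<comment> \<open>The order is reversed so that a maximal element for Zorn's lemma is a minimal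
    functional.\<close>
  define P where "P = (\<lambda>(q :: 'v \<Rightarrow> real) r. \<forall>x. r x \<le> q x)"
  have po: "partial_order_on Q (relation_of P Q)"
  proof (rule partial_order_on_relation_ofI)
    show "P a c" if "P a b" "P b c" for a b c
      using that unfolding P_def by (meson order_trans)
    show "a = b" if "P a b" "P b a" for a b
      using that unfolding P_def by (intro ext) (meson order_antisym)
  qed (simp add: P_def)
  have "\<exists>u\<in>Q. \<forall>a\<in>C. P a u" if "C \<in> Chains (relation_of P Q)" for C
  proof (cases "C = {}")
    case True
    then show ?thesis using p unfolding Q_def by auto
  next
    case False
    have CQ: "C \<subseteq> Q" using that by (rule Chains_relation_of)
    have chain: "(\<forall>x. q x \<le> r x) \<or> (\<forall>x. r x \<le> q x)" if "q \<in> C" "r \<in> C" for q r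
      using \<open>C \<in> Chains _\<close> that unfolding Chains_def relation_of_def P_def by blast
    have sub: "sublinear q" and le: "q x \<le> p x" if "q \<in> C" for q x
      using CQ that unfolding Q_def by auto
    have inf: "sublinear (\<lambda>x. INF q\<in>C. q x)"
      by (rule sublinear_INF_chain(1)[where p = p]) (fact False sub le chain)+
    have inf_le: "(INF q\<in>C. q x) \<le> q x" if "q \<in> C" for q x
      by (rule sublinear_INF_chain(2)[where p = p]) (fact False sub le chain that)+
    obtain q where "q \<in> C" using False by blast
    then have "(INF q\<in>C. q x) \<le> p x" for x
      using inf_le[of q x] le[of q x] by simp
    then have "(\<lambda>x. INF q\<in>C. q x) \<in> Q" using inf unfolding Q_def by blast
    then show ?thesis using inf_le unfolding P_def by (intro bexI) auto
  qed
  then obtain m where m: "m \<in> Q" and min: "\<And>q. q \<in> Q \<Longrightarrow> P m q \<Longrightarrow> q = m"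
    using predicate_Zorn[OF po] by blast
  have sub: "sublinear m" and le: "\<And>x. m x \<le> p x" using m unfolding Q_def by auto
  have odd: "m (- y) = - m y" for y
  proof -
    obtain q where q: "sublinear q" "\<And>x. q x \<le> m x" "q (- y) \<le> - m y"
      using sublinear_minorant_convex[OF sub, of "{y}" "m y"] by auto
    have "q = m"
      using q le by (intro min) (auto simp: Q_def P_def intro: order_trans)
    then show ?thesis using q(3) sublinear_minus[OF sub, of "- y"] by simp
  qed
  have "linear m"
  proof (rule linearI)
    fix x y
    show "m (x + y) = m x + m y"
      using sublinear_add[OF sub, of x y] sublinear_add[OF sub, of "- x" "- y"]
        odd[of x] odd[of y] odd[of "x + y"] by simp
  next
    fix c :: real and x
    show "m (c *\<^sub>R x) = c *\<^sub>R m x"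
    proof (cases "c \<ge> 0")
      case False
      then have "m (- (c *\<^sub>R x)) = - c * m x"
        using sublinear_scale[OF sub, of "- c" x] by simp
      then show ?thesis using odd[of "c *\<^sub>R x"] by simp
    qed (simp add: sublinear_scale[OF sub])
  qed
  then show ?thesis using that le by blast
qed

text \<open>The set x - S is convex and stays at distance \<delta> from 0. A minorant of the norm
  that is at most - \<delta> on its negative dominates a linear functional, which is bounded by the
  norm and separates with margin \<delta>.\<close>

lemma separate_point_closed_convex:
  fixes S :: "'v::real_normed_vector set"
  assumes S: "closed S" "convex S" "S \<noteq> {}" and x: "x \<notin> S"
  obtains f :: "'v \<Rightarrow>\<^sub>L real" and \<delta> where "\<delta> > 0" "\<And>s. s \<in> S \<Longrightarrow> f s + \<delta> \<le> f x"
proof -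
  define \<delta> where "\<delta> = infdist x S"
  have \<delta>: "\<delta> > 0" unfolding \<delta>_def by (rule infdist_pos_not_in_closed[OF S(1,3) x])
  define D where "D = (\<lambda>s. x - s) ` S"
  have D: "convex D" "D \<noteq> {}"
    using convex_translation[OF convex_negations[OF S(2)], of x] S(3)
    unfolding D_def by (simp_all add: image_image)
  have ge: "\<delta> \<le> norm d" if "d \<in> D" for d
    using that infdist_le[of _ S x] unfolding D_def \<delta>_def by (auto simp: dist_norm)
  obtain q where q: "sublinear q" "\<And>v. q v \<le> norm v" "\<And>d. d \<in> D \<Longrightarrow> q (- d) \<le> - \<delta>"
    using sublinear_minorant_convex[OF sublinear_norm D ge] by metis
  obtain g where g: "linear g" "\<And>v. g v \<le> q v"
    using sublinear_dominates_linear[OF q(1)] by metis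
  have g_norm: "g v \<le> norm v" for v using g(2)[of v] q(2)[of v] by simp
  have "norm (g v) \<le> norm v * 1" for v
    using g_norm[of v] g_norm[of "- v"] linear_neg[OF g(1), of v] by (auto simp: abs_le_iff)
  then have "bounded_linear g"
    using g(1) by (intro bounded_linear.intro bounded_linear_axioms.intro exI[of _ 1] allI)
  then have app: "blinfun_apply (Blinfun g) = g" by (rule bounded_linear_Blinfun_apply)
  have "g s + \<delta> \<le> g x" if "s \<in> S" for s
  proof -
    have "x - s \<in> D" using that unfolding D_def by blast
    from order_trans[OF g(2) q(3)[OF this]] show ?thesis
      by (simp add: linear_diff[OF g(1)])
  qed
  with \<delta> show ?thesis by (intro that[of \<delta> "Blinfun g"]) (simp_all add: app)
qed

section \<open>Systems of affine inequalities on a compact convex set\<close>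

text \<open>At a minimizer \<open>b0\<close> of the sum of the squared violations \<open>(max 0 (- g i b))\<^sup>2\<close>, the
  violations themselves are weights contradicting the hypothesis unless they all vanish.\<close>

lemma affine_system_solvable:
  fixes B :: "'v::real_normed_vector set" and g :: "'i \<Rightarrow> 'v \<Rightarrow> real"
  assumes I: "finite I" and B: "compact B" "convex B" "B \<noteq> {}"
    and cont: "\<And>i. i \<in> I \<Longrightarrow> continuous_on B (g i)"
    and aff: "\<And>i x y t. i \<in> I \<Longrightarrow> g i ((1 - t) *\<^sub>R x + t *\<^sub>R y) = (1 - t) * g i x + t * g i y"
    and weights: "\<And>u. (\<And>i. i \<in> I \<Longrightarrow> u i \<ge> 0) \<Longrightarrow> \<exists>b\<in>B. (\<Sum>i\<in>I. u i * g i b) \<ge> 0"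
  shows "\<exists>b\<in>B. \<forall>i\<in>I. g i b \<ge> 0"
proof -
  define V where "V b = (\<Sum>i\<in>I. (max 0 (- g i b))\<^sup>2)" for b
  have "continuous_on B V" unfolding V_def by (intro continuous_intros cont)
  then obtain b0 where b0: "b0 \<in> B" and min: "\<And>b. b \<in> B \<Longrightarrow> V b0 \<le> V b"
    using continuous_attains_inf[OF B(1,3)] by blast
  define u where "u i = max 0 (- g i b0)" for i
  obtain b where b: "b \<in> B" "(\<Sum>i\<in>I. u i * g i b) \<ge> 0"
    using weights[of u] by (auto simp: u_def)
  define d where "d i = g i b - g i b0" for i
  \<comment> \<open>The segment from the minimizer \<open>b0\<close> towards \<open>b\<close> is
    tested: the quadratic expansion divided by t gives, as t tends to 0, the first-order condition
    that the sum of \<open>u i * d i\<close> is at most 0.\<close>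
  have *: "2 * (\<Sum>i\<in>I. u i * d i) \<le> t * (\<Sum>i\<in>I. (d i)\<^sup>2)" if t: "0 < t" "t \<le> 1" for t
  proof -
    let ?c = "(1 - t) *\<^sub>R b0 + t *\<^sub>R b"
    have "?c \<in> B" using B(2) b0 b(1) t by (intro convexD) auto
    then have "V b0 \<le> V ?c" by (rule min)
    also have "\<dots> \<le> (\<Sum>i\<in>I. (u i - t * d i)\<^sup>2)"
      unfolding V_def
    proof (rule sum_mono)
      fix i assume i: "i \<in> I"
      have "g i ?c = g i b0 + t * d i" using aff[OF i] by (simp add: d_def algebra_simps)
      \<comment> \<open>As \<open>u i\<close> dominates \<open>- g i b0\<close>, a positive value of
        \<open>- g i ?c\<close> is at most \<open>u i - t * d i\<close>.\<close>
      then have "\<bar>max 0 (- g i ?c)\<bar> \<le> \<bar>u i - t * d i\<bar>" by (auto simp: u_def)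
      then show "(max 0 (- g i ?c))\<^sup>2 \<le> (u i - t * d i)\<^sup>2" by (simp only: abs_le_square_iff)
    qed
    also have "\<dots> = (\<Sum>i\<in>I. (u i)\<^sup>2 + (- (2 * t)) * (u i * d i) + t\<^sup>2 * (d i)\<^sup>2)"
      by (intro sum.cong refl) (simp add: power2_eq_square algebra_simps)
    also have "\<dots> = V b0 - 2 * t * (\<Sum>i\<in>I. u i * d i) + t\<^sup>2 * (\<Sum>i\<in>I. (d i)\<^sup>2)"
      by (simp only: sum.distrib sum_distrib_left[symmetric]) (simp add: V_def u_def)
    finally have "t * (2 * (\<Sum>i\<in>I. u i * d i)) \<le> t * (t * (\<Sum>i\<in>I. (d i)\<^sup>2))"
      by (simp add: power2_eq_square algebra_simps)
    then show ?thesis using t by simp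
  qed
  have "((\<lambda>t. t * (\<Sum>i\<in>I. (d i)\<^sup>2)) \<longlongrightarrow> 0 * (\<Sum>i\<in>I. (d i)\<^sup>2)) (at_right 0)"
    by (intro tendsto_intros)
  moreover have "eventually (\<lambda>t. 2 * (\<Sum>i\<in>I. u i * d i) \<le> t * (\<Sum>i\<in>I. (d i)\<^sup>2)) (at_right 0)"
    using * by (auto simp: eventually_at_right_field intro!: exI[of _ 1])
  ultimately have "2 * (\<Sum>i\<in>I. u i * d i) \<le> 0 * (\<Sum>i\<in>I. (d i)\<^sup>2)"
    by (rule tendsto_lowerbound) simp
  then have "(\<Sum>i\<in>I. u i * g i b) \<le> (\<Sum>i\<in>I. u i * g i b0)"
    by (simp add: d_def right_diff_distrib sum_subtractf)
  \<comment> \<open>Each \<open>u i\<close> is either 0 or \<open>- g i b0\<close>.\<close>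
  also have "\<dots> = - (\<Sum>i\<in>I. (u i)\<^sup>2)"
    unfolding sum_negf[symmetric]
    by (intro sum.cong refl) (auto simp: u_def power2_eq_square max_def)
  finally have "(\<Sum>i\<in>I. (u i)\<^sup>2) \<le> 0" using b(2) by simp
  then have "(\<Sum>i\<in>I. (u i)\<^sup>2) = 0" by (intro antisym sum_nonneg) auto
  then have "\<forall>i\<in>I. u i = 0" using I by (simp add: sum_nonneg_eq_0_iff)
  then show ?thesis using b0 by (intro bexI[of _ b0]) (auto simp: u_def max_def split: if_splits)
qed

section \<open>Support functions of compact convex sets\<close>

lemma ck_uminus: "C \<in> ck \<Longrightarrow> uminus ` C \<in> ck"
  unfolding ck_def by (auto intro: compact_negations convex_negations)

lemma bdd_above_blinfun_image:
  fixes f :: "'a::banach \<Rightarrow>\<^sub>L real"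
  assumes "C \<in> ck"
  shows "bdd_above (blinfun_apply f ` C)"
proof -
  have "compact (blinfun_apply f ` C)"
    using assms unfolding ck_def
    by (intro compact_continuous_image continuous_intros) simp
  then show ?thesis by (intro bounded_imp_bdd_above) (rule compact_imp_bounded)
qed

lemma support_fun_upper: "C \<in> ck \<Longrightarrow> c \<in> C \<Longrightarrow> blinfun_apply f c \<le> support_fun C f"
  unfolding support_fun_def by (rule cSUP_upper[OF _ bdd_above_blinfun_image])

lemma support_fun_least:
  "C \<in> ck \<Longrightarrow> (\<And>c. c \<in> C \<Longrightarrow> blinfun_apply f c \<le> m) \<Longrightarrow> support_fun C f \<le> m"
  unfolding support_fun_def by (rule cSUP_least) (auto simp: ck_def)

lemma support_fun_attained:
  assumes "C \<in> ck"
  obtains c where "c \<in> C" "support_fun C f = blinfun_apply f c"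
proof -
  have "continuous_on C (blinfun_apply f)" by (intro continuous_intros)
  with assms obtain c where c: "c \<in> C" "\<And>x. x \<in> C \<Longrightarrow> f x \<le> f c"
    using continuous_attains_sup[of C "blinfun_apply f"] unfolding ck_def by blast
  then have "support_fun C f = f c"
    using assms by (intro antisym support_fun_least support_fun_upper)
  with c show ?thesis using that by blast
qed

lemma sublinear_support_fun:
  assumes C: "C \<in> ck"
  shows "sublinear (support_fun C)"
proof (rule sublinearI)
  obtain c where "c \<in> C" "support_fun C 0 = blinfun_apply 0 c" by (rule support_fun_attained[OF C])
  then show "support_fun C 0 = 0" by simp
next
  fix f g
  obtain c where c: "c \<in> C" "support_fun C (f + g) = blinfun_apply (f + g) c"
    by (rule support_fun_attained[OF C])
  then show "support_fun C (f + g) \<le> support_fun C f + support_fun C g"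
    using support_fun_upper[OF C c(1), of f] support_fun_upper[OF C c(1), of g]
    by (simp add: blinfun.add_left)
next
  fix t :: real and f
  assume t: "t > 0"
  obtain c where c: "c \<in> C" "support_fun C (t *\<^sub>R f) = blinfun_apply (t *\<^sub>R f) c"
    by (rule support_fun_attained[OF C])
  then show "support_fun C (t *\<^sub>R f) \<le> t * support_fun C f"
    using support_fun_upper[OF C c(1), of f] t by (simp add: blinfun.scaleR_left)
qed

text \<open>A point outside \<open>C\<close> would be strictly separated from \<open>C\<close>, and
  the separating functional would exceed its support value there.\<close>

lemma mem_ck_if_le_support_fun:
  assumes "C \<in> ck" and "\<And>f. blinfun_apply f c \<le> support_fun C f"
  shows "c \<in> C"
proof (rule ccontr)
  have cl: "closed C" "convex C" "C \<noteq> {}"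
    using assms(1) compact_imp_closed by (auto simp: ck_def)
  assume "c \<notin> C"
  then obtain f :: "'a \<Rightarrow>\<^sub>L real" and \<delta>
    where f: "\<delta> > 0" "\<And>s. s \<in> C \<Longrightarrow> f s + \<delta> \<le> f c"
    using separate_point_closed_convex[OF cl] by metis
  obtain s where "s \<in> C" "support_fun C f = f s" by (rule support_fun_attained[OF assms(1)])
  with f(1) f(2)[of s] assms(2)[of f] show False by simp
qed

lemma ck_eq_Collect: "C \<in> ck \<Longrightarrow> C = {c. \<forall>f. blinfun_apply f c \<le> support_fun C f}"
  using mem_ck_if_le_support_fun support_fun_upper by blast

lemma ck_eqI: "C \<in> ck \<Longrightarrow> D \<in> ck \<Longrightarrow> (\<And>f. support_fun C f = support_fun D f) \<Longrightarrow> C = D"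
  using ck_eq_Collect[of C] ck_eq_Collect[of D] by simp

lemma blinfun_separates_points:
  fixes x y :: "'a::banach"
  assumes "\<And>f :: 'a \<Rightarrow>\<^sub>L real. f x = f y"
  shows "x = y"
proof -
  have "{y} \<in> ck" by (simp add: ck_def)
  then have "x \<in> {y}"
    by (rule mem_ck_if_le_support_fun) (simp add: assms support_fun_def)
  then show ?thesis by simp
qed

lemma support_fun_set_plus:
  assumes B: "B \<in> ck" and C: "C \<in> ck"
  shows "support_fun (B + C) f = support_fun B f + support_fun C f"
proof (rule antisym)
  have upper: "f x \<le> support_fun B f + support_fun C f" if "x \<in> B + C" for x
    using that
    by (elim set_plus_elim) (simp add: blinfun.add_right add_mono support_fun_upper[OF B] support_fun_upper[OF C])
  then have bdd: "bdd_above (blinfun_apply f ` (B + C))" by (intro bdd_aboveI2)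
  have "B + C \<noteq> {}" using B C by (auto simp: ck_def set_plus_def)
  then show "support_fun (B + C) f \<le> support_fun B f + support_fun C f"
    unfolding support_fun_def[of "B + C"] using upper by (rule cSUP_least)
  obtain b where b: "b \<in> B" "support_fun B f = f b" by (rule support_fun_attained[OF B])
  obtain c where c: "c \<in> C" "support_fun C f = f c" by (rule support_fun_attained[OF C])
  have "f (b + c) \<le> support_fun (B + C) f"
    unfolding support_fun_def using b c by (intro cSUP_upper bdd) auto
  then show "support_fun B f + support_fun C f \<le> support_fun (B + C) f"
    by (simp add: b c blinfun.add_right)
qed

lemma support_fun_uminus: "support_fun (uminus ` C) f = support_fun C (- f)"
  by (simp add: support_fun_def image_image blinfun.minus_left blinfun.minus_right)

text \<open>The upper bounds at f and at - f together force f x = - f y for all x in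
  \<open>C\<close> and y in \<open>D\<close>; functionals separate points, so neither set has room
  for two.\<close>

lemma singleton_if_support_fun_cancel:
  assumes C: "C \<in> ck" and D: "D \<in> ck" and cancel: "\<And>f. support_fun C f + support_fun D f = 0"
    and c: "c \<in> C"
  shows "C = {c}" and "D = {- c}"
proof -
  have eq: "f x = - f y" if "x \<in> C" "y \<in> D" for x y and f :: "'a \<Rightarrow>\<^sub>L real"
    using support_fun_upper[OF C that(1), of f] support_fun_upper[OF D that(2), of f]
      support_fun_upper[OF C that(1), of "- f"] support_fun_upper[OF D that(2), of "- f"]
      cancel[of f] cancel[of "- f"]
    by (simp add: blinfun.minus_left)
  have "y = - c" if "y \<in> D" for y
    by (rule blinfun_separates_points) (simp add: eq[OF c that] blinfun.minus_right)
  moreover have "D \<noteq> {}" using D by (simp add: ck_def)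
  ultimately show D_eq: "D = {- c}" by blast
  have "x = c" if "x \<in> C" for x
  proof (rule blinfun_separates_points)
    show "f x = f c" for f :: "'a \<Rightarrow>\<^sub>L real"
      using eq[OF that, of "- c" f] by (simp add: D_eq blinfun.minus_right)
  qed
  with c show "C = {c}" by blast
qed

section \<open>Continuity in the bounded-weak-star topology\<close>

text \<open>The ball with r = 1 is the whole underlying space, so coincidence there already
  determines the topology.\<close>

lemma bw_star_topology_eq:
  "bw_star_topology = subtopology weak_star_topology (dual_ball :: ('a::banach \<Rightarrow>\<^sub>L real) set)"
proof -
  let ?T = "bw_star_topology :: ('a \<Rightarrow>\<^sub>L real) topology"
  have T: "coincides_weak_star_on_balls ?T"
    using is_bw_star_topology_bw_star_topology[where 'a = 'a]
    unfolding is_bw_star_topology_def by (rule conjunct1)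
  have top: "topspace ?T = dual_ball"
    using T unfolding coincides_weak_star_on_balls_def by (rule conjunct1)
  have ball: "{f \<in> dual_ball. norm f \<le> 1} = (dual_ball :: ('a \<Rightarrow>\<^sub>L real) set)" by auto
  have "subtopology ?T {f \<in> dual_ball. norm f \<le> 1} =
      subtopology weak_star_topology {f \<in> dual_ball. norm f \<le> 1}"
    using T[unfolded coincides_weak_star_on_balls_def, THEN conjunct2] by (rule spec)
  then have "subtopology ?T (topspace ?T) = subtopology weak_star_topology dual_ball"
    by (simp only: ball top)
  then show ?thesis by (simp only: subtopology_topspace)
qed

text \<open>Upper semicontinuity is the point where norm compactness matters: on the unit ball a finite
  \<open>\<epsilon>\<close>-net of \<open>C\<close> determines the support function up to \<open>\<epsilon>\<close>.\<close>

lemma bw_star_continuous_support_fun: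
  fixes C :: "'a::banach set"
  assumes C: "C \<in> ck"
  shows "bw_star_continuous (support_fun C)"
proof -
  let ?T = "bw_star_topology :: ('a \<Rightarrow>\<^sub>L real) topology"
  have top: "topspace ?T = dual_ball"
    by (simp add: bw_star_topology_eq strong_operator_topology_topspace)
  have eval: "continuous_map ?T euclidean (\<lambda>f. blinfun_apply f x)" for x
    unfolding bw_star_topology_eq
    by (rule continuous_map_from_subtopology[OF strong_operator_topology_continuous_evaluation])
  have ev_gt: "openin ?T {f \<in> topspace ?T. blinfun_apply f x > r}"
    and ev_lt: "openin ?T {f \<in> topspace ?T. blinfun_apply f x < r}" for x r
    using eval[of x] unfolding continuous_map_upper_lower_semicontinuous_lt by auto
  \<comment> \<open>Lower semicontinuity: a superlevel set is a union of open sets given by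
    evaluations at points of \<open>C\<close>.\<close>
  have gt: "openin ?T {f \<in> topspace ?T. support_fun C f > r}" for r
  proof -
    have "support_fun C f > r \<longleftrightarrow> (\<exists>c\<in>C. f c > r)" for f
      using support_fun_attained[OF C, of f] support_fun_upper[OF C, of _ f] less_le_trans
      by metis
    then have "{f \<in> topspace ?T. support_fun C f > r} = (\<Union>c\<in>C. {f \<in> topspace ?T. f c > r})"
      by auto
    then show ?thesis using ev_gt by auto
  qed
  have lt: "openin ?T {f \<in> topspace ?T. support_fun C f < r}" for r
  proof (subst openin_subopen, intro ballI)
    fix f0 assume f0: "f0 \<in> {f \<in> topspace ?T. support_fun C f < r}"
    \<comment> \<open>Half of the gap pays for passing to the net, the other half for the
      neighbourhood of \<open>f0\<close>.\<close>
    define e where "e = (r - support_fun C f0) / 2"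
    have e: "e > 0" "support_fun C f0 + e + e = r" using f0 by (auto simp: e_def field_simps)
    have "compact C" using C by (simp add: ck_def)
    then obtain N where N: "N \<subseteq> C" "finite N" "C \<subseteq> (\<Union>c\<in>N. ball c e)"
      by (rule compactE_image[of C C "\<lambda>c. ball c e"]) (use e in auto)
    define U where "U = topspace ?T \<inter> (\<Inter>c\<in>N. {f \<in> topspace ?T. f c < support_fun C f0 + e})"
    have "openin ?T U"
      unfolding U_def using N(2) ev_lt by (intro openin_Int_Inter) auto
    moreover have "f0 \<in> U"
    proof -
      have "f0 c < support_fun C f0 + e" if "c \<in> N" for c
        using support_fun_upper[OF C, of c f0] N(1) that e(1) by force
      then show ?thesis using f0 by (auto simp: U_def)
    qed
    moreover have "U \<subseteq> {f \<in> topspace ?T. support_fun C f < r}"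
    proof
      fix f assume f: "f \<in> U"
      then have fT: "f \<in> topspace ?T" and norm: "norm f \<le> 1" by (auto simp: U_def top)
      obtain x where x: "x \<in> C" "support_fun C f = f x" by (rule support_fun_attained[OF C])
      obtain c where c: "c \<in> N" "dist c x < e" using x N(3) by auto
      have "f x - f c = f (x - c)" by (simp add: blinfun.diff_right)
      also have "\<dots> \<le> norm f * norm (x - c)" using norm_blinfun[of f "x - c"] by simp
      also have "\<dots> \<le> 1 * norm (x - c)" using norm by (intro mult_right_mono) auto
      also have "\<dots> < e" using c(2) by (simp add: dist_norm norm_minus_commute)
      finally have "f x < f c + e" by simp
      moreover have "f c < support_fun C f0 + e" using f c(1) by (auto simp: U_def)
      ultimately show "f \<in> {f \<in> topspace ?T. support_fun C f < r}" using x(2) fT e(2) by simp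
    qed
    ultimately show "\<exists>U. openin ?T U \<and> f0 \<in> U \<and> U \<subseteq> {f \<in> topspace ?T. support_fun C f < r}"
      by blast
  qed
  show ?thesis
    unfolding bw_star_continuous_def continuous_map_upper_lower_semicontinuous_lt
    using gt lt by blast
qed

section \<open>Existence and uniqueness of the generalized Hukuhara difference\<close>

text \<open>Homogeneity lets f, g and f + g be shrunk into the unit ball by one factor; the summand
  1 in its denominator keeps it defined when both norms vanish.\<close>

lemma sublinear_if_subadditive_on_dual_ball:
  fixes p :: "('a::banach \<Rightarrow>\<^sub>L real) \<Rightarrow> real"
  assumes sub: "subadditive_on dual_ball p"
    and scale: "\<And>c f. c \<ge> 0 \<Longrightarrow> p (c *\<^sub>R f) = c * p f"
  shows "sublinear p"
proof (rule sublinearI)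
  fix f g :: "'a \<Rightarrow>\<^sub>L real"
  define c where "c = inverse (1 + norm f + norm g)"
  have c: "c > 0" unfolding c_def by (simp add: add_pos_nonneg)
  have in_ball: "c *\<^sub>R h \<in> dual_ball" if "norm h \<le> norm f + norm g" for h :: "'a \<Rightarrow>\<^sub>L real"
    using that c by (simp add: c_def field_simps)
  have "p (c *\<^sub>R f + c *\<^sub>R g) \<le> p (c *\<^sub>R f) + p (c *\<^sub>R g)"
    using sub in_ball[of f] in_ball[of g] in_ball[of "f + g"] norm_triangle_ineq[of f g]
    unfolding subadditive_on_def by (simp add: scaleR_add_right)
  then have "c * p (f + g) \<le> c * (p f + p g)"
    using c by (simp add: scaleR_add_right[symmetric] scale distrib_left)
  then show "p (f + g) \<le> p f + p g" using c by simp
qed (use scale[of 0 0] scale in auto)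

lemma minkowski_summand_exists:
  fixes A B :: "'a::banach set"
  assumes A: "A \<in> ck" and B: "B \<in> ck"
    and sub: "subadditive_on dual_ball (\<lambda>f. support_fun A f - support_fun B f)"
  obtains C where "C \<in> ck" "A = B + C"
proof -
  define s where "s f = support_fun A f - support_fun B f" for f
  have s: "sublinear s"
    unfolding s_def using sub
    by (rule sublinear_if_subadditive_on_dual_ball)
       (simp add: sublinear_scale[OF sublinear_support_fun] A B right_diff_distrib)
  define C where "C = {c. \<forall>f. blinfun_apply f c \<le> s f}"
  have C_Int: "C = (\<Inter>f. {c. blinfun_apply f c \<le> s f})" by (auto simp: C_def)
  have BC: "b + c \<in> A" if "b \<in> B" "c \<in> C" for b c
  proof (rule mem_ck_if_le_support_fun[OF A])
    show "f (b + c) \<le> support_fun A f" for f :: "'a \<Rightarrow>\<^sub>L real"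
      using support_fun_upper[OF B that(1), of f] that(2)
      by (auto simp: C_def s_def blinfun.add_right dest!: spec[of _ f])
  qed
  have decomp: "\<exists>b\<in>B. a - b \<in> C" if a: "a \<in> A" for a
  proof -
    \<comment> \<open>The admissible \<open>b\<close> form an intersection of closed sets, so
      compactness of \<open>B\<close> reduces the claim to finitely many functionals.\<close>
    have "B \<inter> (\<Inter>f\<in>UNIV. {b. blinfun_apply f (a - b) \<le> s f}) \<noteq> {}"
    proof (rule compact_imp_fip_image)
      show "compact B" using B by (simp add: ck_def)
      show "closed {b. blinfun_apply f (a - b) \<le> s f}" for f
        by (intro closed_Collect_le continuous_intros)
      fix F :: "('a \<Rightarrow>\<^sub>L real) set" assume F: "finite F"
      have "\<exists>b\<in>B. \<forall>f\<in>F. s f - f (a - b) \<ge> 0"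
      proof (rule affine_system_solvable[OF F])
        show "compact B" "convex B" "B \<noteq> {}" using B by (simp_all add: ck_def)
        show "continuous_on B (\<lambda>b. s f - f (a - b))" for f by (intro continuous_intros)
        show "s f - f (a - ((1 - t) *\<^sub>R x + t *\<^sub>R y)) =
            (1 - t) * (s f - f (a - x)) + t * (s f - f (a - y))" for f t x y
          by (simp add: blinfun.bilinear_simps algebra_simps)
        fix u :: "('a \<Rightarrow>\<^sub>L real) \<Rightarrow> real" assume u: "\<And>f. f \<in> F \<Longrightarrow> u f \<ge> 0"
        define h where "h = (\<Sum>f\<in>F. u f *\<^sub>R f)"
        obtain b where b: "b \<in> B" "support_fun B h = h b"
          by (rule support_fun_attained[OF B])
        \<comment> \<open>Since \<open>b\<close> maximizes \<open>h\<close> on \<open>B\<close>, the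
          right side equals \<open>support_fun A h - h a\<close>.\<close>
        have "0 \<le> s h - h (a - b)"
          using support_fun_upper[OF A a, of h] b(2) by (simp add: s_def blinfun.diff_right)
        also have "\<dots> \<le> (\<Sum>f\<in>F. u f * s f) - h (a - b)"
          using sublinear_sum[OF s F u] by (simp add: h_def)
        also have "\<dots> = (\<Sum>f\<in>F. u f * (s f - f (a - b)))"
          by (simp add: h_def blinfun.sum_left blinfun.scaleR_left right_diff_distrib sum_subtractf)
        finally show "\<exists>b\<in>B. (\<Sum>f\<in>F. u f * (s f - f (a - b))) \<ge> 0" using b(1) by blast
      qed
      then show "B \<inter> (\<Inter>f\<in>F. {b. blinfun_apply f (a - b) \<le> s f}) \<noteq> {}" by auto
    qed
    then show ?thesis by (auto simp: C_def)
  qed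
  have "A = B + C"
  proof (intro equalityI subsetI)
    fix a assume "a \<in> A"
    then obtain b where "b \<in> B" "a - b \<in> C" using decomp by blast
    then have "b + (a - b) \<in> B + C" by (rule set_plus_intro)
    then show "a \<in> B + C" by simp
  qed (auto elim!: set_plus_elim intro: BC)
  moreover have "C \<in> ck"
  proof -
    obtain a b where ab: "a \<in> A" "b \<in> B" using A B by (auto simp: ck_def)
    then have "C \<noteq> {}" using decomp by blast
    moreover have "convex C"
      unfolding C_Int
    proof (intro convex_INT)
      show "convex {c. blinfun_apply f c \<le> s f}" for f
        using convex_linear_vimage[of "blinfun_apply f" "{..s f}"]
        by (simp add: vimage_def bounded_linear.linear blinfun.bounded_linear_right)
    qed
    moreover have "closed C"
      unfolding C_Int by (intro closed_INT ballI closed_Collect_le continuous_intros)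
    \<comment> \<open>Subtracting one fixed b in \<open>B\<close> from b + C \<subseteq> A places
      the closed set \<open>C\<close> inside a compact set.\<close>
    moreover have "C \<subseteq> (\<lambda>x. x - b) ` A"
      using BC[OF ab(2)] by (force simp: image_iff intro: exI[of _ "b + _"])
    moreover have "compact ((\<lambda>x. x - b) ` A)"
      using A by (intro compact_continuous_image continuous_intros) (simp add: ck_def)
    ultimately show ?thesis
      by (metis (mono_tags, lifting) ck_def compact_Int_closed inf.absorb_iff2 mem_Collect_eq)
  qed
  ultimately show ?thesis using that by blast
qed

section \<open>Consequences of a Minkowski decomposition, and uniqueness\<close>

lemma support_fun_minkowski_summand:
  assumes "B \<in> ck" "C \<in> ck" "A = B + C"
  shows "support_fun C f = support_fun A f - support_fun B f"
  using support_fun_set_plus[OF assms(1,2)] assms(3) by simp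

text \<open>Necessity of the conditions: the difference is itself the support function of the
  summand \<open>C\<close>.\<close>

lemma minkowski_summand_conditions:
  assumes "B \<in> ck" "C \<in> ck" "A = B + C"
  shows "bw_star_continuous (\<lambda>f. support_fun A f - support_fun B f)"
    and "subadditive_on dual_ball (\<lambda>f. support_fun A f - support_fun B f)"
proof -
  have "(\<lambda>f. support_fun A f - support_fun B f) = support_fun C"
    by (rule ext) (simp add: support_fun_minkowski_summand[OF assms])
  then show "bw_star_continuous (\<lambda>f. support_fun A f - support_fun B f)"
    "subadditive_on dual_ball (\<lambda>f. support_fun A f - support_fun B f)"
    using bw_star_continuous_support_fun[OF assms(2)] sublinear_add[OF sublinear_support_fun[OF assms(2)]]
    by (simp_all add: subadditive_on_def)
qed

text \<open>The support functions of \<open>C\<close> and \<open>D\<close> are opposite differences,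
  hence cancel. This yields both the singleton case and the mixed case of uniqueness.\<close>

lemma both_summands_opposite:
  fixes A B :: "'a::banach set"
  assumes A: "A \<in> ck" and B: "B \<in> ck" and C: "C \<in> ck" and D: "D \<in> ck"
    and eqs: "A = B + C" "B = A + D"
  obtains c where "C = {c}" "D = {- c}"
proof -
  have cancel: "support_fun C f + support_fun D f = 0" for f
    using support_fun_minkowski_summand[OF B C eqs(1)] support_fun_minkowski_summand[OF A D eqs(2)]
    by simp
  obtain c where "c \<in> C" using C by (auto simp: ck_def)
  then have "C = {c}" "D = {- c}" by (rule singleton_if_support_fun_cancel[OF C D cancel])+
  then show ?thesis by (rule that)
qed

lemma is_gH_diff_unique:
  fixes A B :: "'a::banach set"
  assumes A: "A \<in> ck" and B: "B \<in> ck" and C: "is_gH_diff A B C" and D: "is_gH_diff A B D"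
  shows "C = D"
proof -
  have ck: "C \<in> ck" "D \<in> ck" "uminus ` C \<in> ck" "uminus ` D \<in> ck"
    using C D ck_uminus unfolding is_gH_diff_def by blast+
  have mixed: "X = Y" if XY: "A = B + X" "B = A + uminus ` Y" "X \<in> ck" "Y \<in> ck" for X Y
  proof -
    obtain c where c: "X = {c}" "uminus ` Y = {- c}"
      by (rule both_summands_opposite[OF A B XY(3) ck_uminus[OF XY(4)] XY(1,2)])
    have "Y = uminus ` uminus ` Y" by (simp add: image_image)
    also have "\<dots> = X" unfolding c by simp
    finally show ?thesis by (rule sym)
  qed
  consider "A = B + C" "A = B + D" | "A = B + C" "B = A + uminus ` D"
    | "B = A + uminus ` C" "A = B + D" | "B = A + uminus ` C" "B = A + uminus ` D"
    using C D unfolding is_gH_diff_def by blast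
  then show ?thesis
  proof cases
    case 1
    show ?thesis
      by (rule ck_eqI[OF ck(1,2)])
         (simp only: support_fun_minkowski_summand[OF B ck(1) 1(1)]
           support_fun_minkowski_summand[OF B ck(2) 1(2)])
  next
    case 2
    then show ?thesis by (rule mixed[OF _ _ ck(1,2)])
  next
    case 3
    from mixed[OF 3(2,1) ck(2,1)] show ?thesis by (rule sym)
  next
    case 4
    \<comment> \<open>Alternative (ii) determines the reflected sets; injectivity of negation then
      gives the sets themselves.\<close>
    have "uminus ` C = uminus ` D"
      by (rule ck_eqI[OF ck(3,4)])
         (simp only: support_fun_minkowski_summand[OF A ck(3) 4(1)]
           support_fun_minkowski_summand[OF A ck(4) 4(2)])
    then show ?thesis by (simp only: inj_image_eq_iff[OF inj_uminus])
  qed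
qed

lemma gH_diff_eqI:
  assumes "A \<in> ck" "B \<in> ck" "is_gH_diff A B C"
  shows "gH_diff_exists A B" and "A \<ominus>\<^sub>g B = C"
proof -
  show "gH_diff_exists A B" using assms(3) unfolding gH_diff_exists_def by (rule exI)
  show "A \<ominus>\<^sub>g B = C"
    unfolding gH_diff_def using assms(3)
    by (rule the_equality) (rule is_gH_diff_unique[OF assms(1,2) _ assms(3)])
qed

section \<open>The four cases, according to which difference is a support function\<close>

theorem proposition5p5:
  fixes A B :: "'a::banach set"
    and s1 s2 :: "('a \<Rightarrow>\<^sub>L real) \<Rightarrow> real"
  assumes "A \<in> ck" and "B \<in> ck"
  defines "s1 \<equiv> \<lambda>f. support_fun A f - support_fun B f"
    and "s2 \<equiv> \<lambda>f. support_fun B f - support_fun A f"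
  shows
    "((bw_star_continuous s1 \<and> subadditive_on dual_ball s1) \<and>
      (bw_star_continuous s2 \<and> subadditive_on dual_ball s2)
      \<longrightarrow> gH_diff_exists A B \<and> A \<ominus>\<^sub>g B \<in> ck \<and> is_singleton (A \<ominus>\<^sub>g B))
   \<and> ((bw_star_continuous s1 \<and> subadditive_on dual_ball s1) \<and>
      \<not> (bw_star_continuous s2 \<and> subadditive_on dual_ball s2)
      \<longrightarrow> gH_diff_exists A B \<and> A \<ominus>\<^sub>g B \<in> ck \<and> A = B + (A \<ominus>\<^sub>g B) \<and>
          (\<forall>f\<in>dual_ball. support_fun (A \<ominus>\<^sub>g B) f = s1 f))
   \<and> (\<not> (bw_star_continuous s1 \<and> subadditive_on dual_ball s1) \<and>
      (bw_star_continuous s2 \<and> subadditive_on dual_ball s2)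
      \<longrightarrow> gH_diff_exists A B \<and> A \<ominus>\<^sub>g B \<in> ck \<and> B = A + uminus ` (A \<ominus>\<^sub>g B) \<and>
          (\<forall>f\<in>dual_ball. support_fun (A \<ominus>\<^sub>g B) f
              = support_fun (uminus ` B) f - support_fun (uminus ` A) f))
   \<and> (\<not> (bw_star_continuous s1 \<and> subadditive_on dual_ball s1) \<and>
      \<not> (bw_star_continuous s2 \<and> subadditive_on dual_ball s2)
      \<longrightarrow> \<not> gH_diff_exists A B)"
proof -
  note A = \<open>A \<in> ck\<close> and B = \<open>B \<in> ck\<close>
  have one: "gH_diff_exists A B \<and> A \<ominus>\<^sub>g B \<in> ck \<and> A = B + (A \<ominus>\<^sub>g B) \<and>
      (\<forall>f. support_fun (A \<ominus>\<^sub>g B) f = s1 f)" if s1: "subadditive_on dual_ball s1"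
  proof -
    obtain C where C: "C \<in> ck" "A = B + C"
      by (rule minkowski_summand_exists[OF A B s1[unfolded s1_def]])
    then have "is_gH_diff A B C" by (simp add: is_gH_diff_def)
    note gH = gH_diff_eqI[OF A B this]
    show ?thesis
      unfolding gH(2) s1_def using gH(1) C support_fun_minkowski_summand[OF B C] by blast
  qed
  have two: "gH_diff_exists A B \<and> A \<ominus>\<^sub>g B \<in> ck \<and> B = A + uminus ` (A \<ominus>\<^sub>g B) \<and>
      (\<forall>f. support_fun (A \<ominus>\<^sub>g B) f = support_fun (uminus ` B) f - support_fun (uminus ` A) f)"
    if s2: "subadditive_on dual_ball s2"
  proof -
    obtain D where D: "D \<in> ck" "B = A + D"
      by (rule minkowski_summand_exists[OF B A s2[unfolded s2_def]])
    have DD: "uminus ` uminus ` D = D" by (simp add: image_image)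
    \<comment> \<open>The summand \<open>D\<close> plays the role of - C in alternative (ii), so the
      difference is its reflection.\<close>
    have "is_gH_diff A B (uminus ` D)"
      using D ck_uminus by (simp add: is_gH_diff_def DD)
    note gH = gH_diff_eqI[OF A B this]
    show ?thesis
      \<comment> \<open>Reflection moves every support function to - f, where the difference formula
        for \<open>D\<close> applies.\<close>
      unfolding gH(2) DD support_fun_uminus
      using gH(1) D ck_uminus support_fun_minkowski_summand[OF A D] by blast
  qed
  have single: "is_singleton (A \<ominus>\<^sub>g B)"
    if s1: "subadditive_on dual_ball s1" and s2: "subadditive_on dual_ball s2"
  proof -
    \<comment> \<open>By uniqueness the same set satisfies both alternatives, so it and its
      reflection are summands in opposite directions.\<close>
    obtain c where "A \<ominus>\<^sub>g B = {c}"
      by (rule both_summands_opposite[OF A B, of "A \<ominus>\<^sub>g B" "uminus ` (A \<ominus>\<^sub>g B)"])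
         (use one[OF s1] two[OF s2] ck_uminus in blast)+
    then show ?thesis by simp
  qed
  \<comment> \<open>The contrapositive of the last case: alternative (i) makes \<open>s1\<close> the
    support function of C, alternative (ii) makes \<open>s2\<close> that of - C.\<close>
  have none: "(bw_star_continuous s1 \<and> subadditive_on dual_ball s1) \<or>
      (bw_star_continuous s2 \<and> subadditive_on dual_ball s2)" if ex: "gH_diff_exists A B"
  proof -
    obtain C where C: "C \<in> ck" "A = B + C \<or> B = A + uminus ` C"
      using ex unfolding gH_diff_exists_def is_gH_diff_def by blast
    then show ?thesis
      using minkowski_summand_conditions[OF B C(1)]
        minkowski_summand_conditions[OF A ck_uminus[OF C(1)]]
      unfolding s1_def s2_def by blast
  qed
  show ?thesis using one two single none by blast
qed

end
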